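(* Let $n\ge 2$, $m\ge1$. Assume that $\alpha_i>1$ and $l_i>0$ for every $i\in\{1,\dots,m\}$, and that $g:\mathbb{R}^n\to\mathbb{R}$ is locally Lipschitz continuous on $\mathbb{R}^n$. Then for every $\mathbf{y}\in\Omega$ and every $\mathbf{p}=(p_{P_1}^\top,\dots,p_{P_m}^\top,p_E^\top)^\top\in D^+V^g(\mathbf{y})$, $$-\sum_{i=1}^m\alpha_i\|p_{P_i}\|+\|p_E\|\le 0.$$
   Context: $\|\cdot\|$ is the Euclidean norm. Points of $\mathbb{R}^{(m+1)n}$ are written $\mathbf{y}=(x_{P_1}^\top,\dots,x_{P_m}^\top,x_E^\top)^\top$ with blocks in $\mathbb{R}^n$, and similarly for $\mathbf{p}$. $\Omega=\{\mathbf{y}:\|x_{P_i}-x_E\|>l_i\ \text{for all } i\}$. For $\mathbf{y}\in\Omega$: $d_i(x;x_{P_i},x_E)=-\|x-x_{P_i}\|+\alpha_i\|x-x_E\|+l_i$, $\mathcal{D}_i(x_{P_i},x_E)=\{x\in\mathbb{R}^n:d_i(x;x_{P_i},x_E)\le 0\}$, $\mathcal{D}^*(\mathbf{y})=\bigcap_{i=1}^m\mathcal{D}_i(x_{P_i},x_E)$, $V^g(\mathbf{y})=\min_{x\in\mathcal{D}^*(\mathbf{y})}g(x)$. The superdifferential $D^+f(\mathbf{y})$ of $f:\Omega\to\mathbb{R}$ is the set of $\mathbf{p}\in\mathbb{R}^{(m+1)n}$ with $\limsup_{\mathbf{y}'\to\mathbf{y}}\frac{f(\mathbf{y}')-f(\mathbf{y})-\mathbf{p}^\top(\mathbf{y}'-\mathbf{y})}{\|\mathbf{y}'-\mathbf{y}\|}\le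 0$. *)

theory Defs
  imports "HOL-Analysis.Analysis"
begin

text \<open>
  The dimension \<open>n\<close> is \<open>CARD('n)\<close> and the pursuers are indexed by \<open>'m\<close>. A point of
  the state space of dimension \<open>(m + 1) n\<close> is a pair \<open>(xP, xE)\<close>, where \<open>xP $ i\<close> is the block of the \<open>i\<close>-th pursuer and
  \<open>xE\<close> that of the evader. The library norm and inner product on this product type are the
  Euclidean ones on the stacked vector.
\<close>

type_synonym ('m, 'n) state = "((real ^ 'n) ^ 'm) \<times> (real ^ 'n)"

definition \<Omega> :: "('m::finite \<Rightarrow> real) \<Rightarrow> ('m, 'n::finite) state set" where
  "\<Omega> l = {(xP, xE). \<forall>i. norm (xP $ i - xE) > l i}"

definition d :: "real \<Rightarrow> real \<Rightarrow> real ^ 'n \<Rightarrow> real ^ 'n \<Rightarrow> real ^ 'n::finite \<Rightarrow> real" where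
  "d a r xP xE x = - norm (x - xP) + a * norm (x - xE) + r"

definition dom_region :: "real \<Rightarrow> real \<Rightarrow> real ^ 'n \<Rightarrow> real ^ 'n \<Rightarrow> (real ^ 'n::finite) set" where
  "dom_region a r xP xE = {x. d a r xP xE x \<le> 0}"

definition Dstar ::
  "('m::finite \<Rightarrow> real) \<Rightarrow> ('m \<Rightarrow> real) \<Rightarrow> ('m, 'n::finite) state \<Rightarrow> (real ^ 'n) set" where
  "Dstar \<alpha> l y = (\<Inter>i. dom_region (\<alpha> i) (l i) (fst y $ i) (snd y))"

text \<open>
  The minimum is the value of \<open>g\<close> at a minimiser; lemma \<open>Vg_is_minimum\<close> below shows that under
  the standing assumptions a minimiser exists.
\<close>

definition Vg ::
  "('m::finite \<Rightarrow> real) \<Rightarrow> ('m \<Rightarrow> real) \<Rightarrow> (real ^ 'n \<Rightarrow> real) \<Rightarrow> ('m, 'n::finite) state \<Rightarrow> real" where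
  "Vg \<alpha> l g y = g (ARG_MIN g x. x \<in> Dstar \<alpha> l y)"

text \<open>
  The function lives on \<open>S\<close>, so the upper limit is taken over \<open>y' \<rightarrow> y\<close> with \<open>y' \<in> S\<close>,
  \<open>y' \<noteq> y\<close>, and in the extended reals, as it may be infinite.
\<close>

definition superdifferential :: "'a::real_inner set \<Rightarrow> ('a \<Rightarrow> real) \<Rightarrow> 'a \<Rightarrow> 'a set" where
  "superdifferential S f y =
    {p. Limsup (at y within S) (\<lambda>y'. ereal ((f y' - f y - p \<bullet> (y' - y)) / norm (y' - y))) \<le> 0}"

definition locally_lipschitz :: "('a::metric_space \<Rightarrow> 'b::metric_space) \<Rightarrow> bool" where
  "locally_lipschitz f \<longleftrightarrow> (\<forall>x. \<exists>u>0. \<exists>L. L-lipschitz_on (cball x u) f)"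

lemma Vg_is_minimum:
  fixes \<alpha> l :: "'m::finite \<Rightarrow> real" and g :: "real ^ 'n::finite \<Rightarrow> real"
  assumes a: "\<And>i. \<alpha> i > 1" and g: "locally_lipschitz g" and y: "y \<in> \<Omega> l"
  shows "Vg \<alpha> l g y \<in> g ` Dstar \<alpha> l y" and "\<And>x. x \<in> Dstar \<alpha> l y \<Longrightarrow> Vg \<alpha> l g y \<le> g x"
proof -
  obtain xP xE where yy: "y = (xP, xE)" by (cases y)
  have E: "xE \<in> Dstar \<alpha> l y"
    using y by (auto simp: yy \<Omega>_def Dstar_def dom_region_def d_def norm_minus_commute intro: less_imp_le)
  have closed: "closed (Dstar \<alpha> l y)"
    unfolding Dstar_def dom_region_def d_def
    by (intro closed_INT ballI closed_Collect_le continuous_intros)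
  fix i :: 'm
  define B where "B = (norm (xP $ i - xE) - l i) / (\<alpha> i - 1)"
  have "x \<in> cball xE B" if "x \<in> Dstar \<alpha> l y" for x
  proof -
    have "\<alpha> i * norm (x - xE) + l i \<le> norm (x - xP $ i)"
      using that by (auto simp: yy Dstar_def dom_region_def d_def dest: spec[of _ i])
    also have "\<dots> \<le> norm (x - xE) + norm (xP $ i - xE)"
      using norm_triangle_ineq4[of "x - xE" "xP $ i - xE"] by simp
    finally have "(\<alpha> i - 1) * norm (x - xE) \<le> norm (xP $ i - xE) - l i"
      by (simp add: algebra_simps)
    then show ?thesis
      using a[of i] by (simp add: B_def dist_norm norm_minus_commute field_simps)
  qed
  then have "bounded (Dstar \<alpha> l y)"
    using bounded_cball bounded_subset by blast
  then have compact: "compact (Dstar \<alpha> l y)"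
    using closed by (simp add: compact_eq_bounded_closed)
  have "continuous_on UNIV g"
  proof (rule continuous_at_imp_continuous_on, rule ballI)
    fix x
    obtain u L where u: "u > 0" and L: "L-lipschitz_on (cball x u) g"
      using g unfolding locally_lipschitz_def by blast
    show "isCont g x"
      using continuous_on_interior[OF lipschitz_on_continuous_on[OF L], of x] u by simp
  qed
  then have "continuous_on (Dstar \<alpha> l y) g"
    using continuous_on_subset by blast
  then obtain z where "is_arg_min g (\<lambda>x. x \<in> Dstar \<alpha> l y) z"
    using continuous_attains_inf[OF compact] E by (fastforce simp: is_arg_min_linorder)
  then have "is_arg_min g (\<lambda>x. x \<in> Dstar \<alpha> l y) (ARG_MIN g x. x \<in> Dstar \<alpha> l y)"
    unfolding arg_min_def by (rule someI)
  then show "Vg \<alpha> l g y \<in> g ` Dstar \<alpha> l y" "\<And>x. x \<in> Dstar \<alpha> l y \<Longrightarrow> Vg \<alpha> l g y \<le> g x"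
    by (auto simp: Vg_def is_arg_min_linorder)
qed

end

theory Submission
  imports Defs
begin

text \<open>
  Fix an evader direction \<open>w\<close>. Let \<open>z\<^sub>i\<close> be the point where the ray from \<open>x\<^sub>E\<close> in direction \<open>w\<close>
  leaves \<open>\<D>\<^sub>i\<close>, and let pursuer \<open>i\<close> run towards \<open>z\<^sub>i\<close> at speed \<open>\<alpha>\<^sub>i\<close> while the evader runs at unit
  speed along \<open>w\<close>. Then \<open>\<D>\<^sub>i\<close> shrinks, so \<open>V\<^sup>g\<close> does not decrease along this line, and every
  \<open>p \<in> D\<^sup>+ V\<^sup>g(y)\<close> has nonnegative product with its direction. The inequality is this statement for
  \<open>w = - p\<^sub>E / \<parallel>p\<^sub>E\<parallel>\<close>.
\<close>

text \<open>With evader at distance \<open>t\<close> from \<open>z\<close> and pursuer at distance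
  \<open>a * t + r\<close>, the point \<open>z\<close> lies on the boundary of the region for every
  \<open>t \<ge> 0\<close>. Squaring the nonnegative sides of the defining inequality cancels the
  terms \<open>a\<^sup>2 * t\<^sup>2\<close> and \<open>r\<^sup>2\<close>; what is left depends on
  \<open>t\<close> only through \<open>norm (x - z + t *\<^sub>R w) - t\<close> and a linear
  term.\<close>

lemma dom_region_iff_quadratic:
  fixes z w e x :: "real ^ 'n::finite"
  assumes "a \<ge> 0" "r \<ge> 0" "norm w = 1" "norm e = 1"
  shows "x \<in> dom_region a r (z - (a * t + r) *\<^sub>R e) (z - t *\<^sub>R w) \<longleftrightarrow>
    (a\<^sup>2 - 1) * (norm (x - z))\<^sup>2 + 2 * a * r * (norm (x - z + t *\<^sub>R w) - t)
      + 2 * a * t * (a * ((x - z) \<bullet> w) - (x - z) \<bullet> e) - 2 * r * ((x - z) \<bullet> e) \<le> 0"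
proof -
  define X where "X = x - z"
  have sq: "(norm (X + c *\<^sub>R u))\<^sup>2 = (norm X)\<^sup>2 + 2 * c * (X \<bullet> u) + c\<^sup>2" if "norm u = 1" for c u
    using dot_norm[of X "c *\<^sub>R u"] that by simp
  have "x \<in> dom_region a r (z - (a * t + r) *\<^sub>R e) (z - t *\<^sub>R w) \<longleftrightarrow>
      a * norm (X + t *\<^sub>R w) + r \<le> norm (X + (a * t + r) *\<^sub>R e)"
    unfolding dom_region_def d_def X_def by (simp add: diff_diff_eq2 diff_add_eq)
  also have "\<dots> \<longleftrightarrow> (a * norm (X + t *\<^sub>R w) + r)\<^sup>2 \<le> (norm (X + (a * t + r) *\<^sub>R e))\<^sup>2"
    using assms by (simp only: abs_le_square_iff[symmetric]) simp
  also have "(a * norm (X + t *\<^sub>R w) + r)\<^sup>2 =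
      a\<^sup>2 * (norm (X + t *\<^sub>R w))\<^sup>2 + 2 * a * r * norm (X + t *\<^sub>R w) + r\<^sup>2"
    by (simp add: power2_eq_square algebra_simps)
  finally show ?thesis
    unfolding sq[OF assms(3)] sq[OF assms(4)] X_def[symmetric] by (simp add: power2_eq_square algebra_simps)
qed

text \<open>Here \<open>t\<close> is the evader's remaining distance to \<open>z\<close>, so the
  region shrinks as both players approach. The quadratic criterion \<open>F\<close> is nonincreasing
  in \<open>t\<close> once \<open>k\<close>, its linear coefficient up to the factor
  \<open>2 * a\<close>, is nonpositive, and membership at \<open>t\<close> forces that sign.\<close>

lemma dom_region_antimono_pursuit:
  fixes z w e :: "real ^ 'n::finite"
  assumes a: "a \<ge> 1" and r: "r \<ge> 0" and w: "norm w = 1" and e: "norm e = 1"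
    and t: "0 < t" "t \<le> s"
  shows "dom_region a r (z - (a * t + r) *\<^sub>R e) (z - t *\<^sub>R w)
    \<subseteq> dom_region a r (z - (a * s + r) *\<^sub>R e) (z - s *\<^sub>R w)"
proof
  fix x
  define X where "X = x - z"
  define k where "k = a * (X \<bullet> w) - X \<bullet> e"
  define F where "F t = (a\<^sup>2 - 1) * (norm X)\<^sup>2 + 2 * a * r * (norm (X + t *\<^sub>R w) - t)
    + 2 * a * t * k - 2 * r * (X \<bullet> e)" for t
  have iff: "x \<in> dom_region a r (z - (a * t + r) *\<^sub>R e) (z - t *\<^sub>R w) \<longleftrightarrow> F t \<le> 0" for t
    using dom_region_iff_quadratic[of a r w e x z t] a r w e by (simp add: F_def k_def X_def)
  assume "x \<in> dom_region a r (z - (a * t + r) *\<^sub>R e) (z - t *\<^sub>R w)"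
  then have Ft: "F t \<le> 0"
    by (simp add: iff)
  \<comment> \<open>Replacing \<open>norm (X + t *\<^sub>R w) - t\<close> by its lower bound
    \<open>X \<bullet> w\<close> makes the terms with factor \<open>r\<close> add up to
    \<open>2 * r * k\<close>, which leaves a positive multiple of \<open>k\<close> below
    \<open>F t\<close>.\<close>
  have "X \<bullet> w + t = (X + t *\<^sub>R w) \<bullet> w"
    using w by (simp add: inner_add_left norm_eq_1)
  also have "\<dots> \<le> norm (X + t *\<^sub>R w)"
    using norm_cauchy_schwarz[of "X + t *\<^sub>R w" w] w by simp
  finally have "2 * a * r * (X \<bullet> w) \<le> 2 * a * r * (norm (X + t *\<^sub>R w) - t)"
    using a r by (intro mult_left_mono) auto
  moreover have "0 \<le> (a\<^sup>2 - 1) * (norm X)\<^sup>2"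
    using a by simp
  ultimately have "2 * (a * t + r) * k \<le> F t"
    unfolding F_def k_def by (simp add: algebra_simps)
  with Ft have "(a * t + r) * k \<le> 0"
    by linarith
  moreover have "0 < a * t + r"
    using a r t by (simp add: add_pos_nonneg)
  ultimately have k: "k \<le> 0"
    by (simp add: mult_le_0_iff)
  have "norm (X + s *\<^sub>R w) \<le> norm (X + t *\<^sub>R w) + norm ((s - t) *\<^sub>R w)"
    using norm_triangle_ineq[of "X + t *\<^sub>R w" "(s - t) *\<^sub>R w"] by (simp add: algebra_simps)
  then have "2 * a * r * (norm (X + s *\<^sub>R w) - s) \<le> 2 * a * r * (norm (X + t *\<^sub>R w) - t)"
    using a r w t by (intro mult_left_mono) auto
  moreover have "2 * a * s * k \<le> 2 * a * t * k"
    using a t k by (intro mult_right_mono_neg mult_left_mono) auto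
  ultimately have "F s \<le> F t"
    unfolding F_def by linarith
  with Ft show "x \<in> dom_region a r (z - (a * s + r) *\<^sub>R e) (z - s *\<^sub>R w)"
    by (simp add: iff)
qed

lemma ray_exits_dom_region:
  fixes xP xE w :: "'a::real_normed_vector"
  assumes "a > 1" "norm (xP - xE) > r" "norm w = 1"
  obtains s where "s > 0" "norm (xE + s *\<^sub>R w - xP) = a * s + r"
proof -
  \<comment> \<open>Chosen so that \<open>a * b + r = b + norm (xP - xE)\<close>, which by the
    triangle inequality is at least the distance from the pursuer to
    \<open>xE + b *\<^sub>R w\<close>. The sign change needed for the intermediate value theorem
    thus occurs on \<open>{0..b}\<close>.\<close>
  define b where "b = (norm (xP - xE) - r) / (a - 1)"
  have b: "b > 0" "(a - 1) * b = norm (xP - xE) - r"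
    using assms by (simp_all add: b_def)
  define f where "f s = a * s + r - norm (xE + s *\<^sub>R w - xP)" for s
  have f0: "f 0 < 0"
    using assms by (simp add: f_def norm_minus_commute)
  have "norm (xE + b *\<^sub>R w - xP) \<le> norm (b *\<^sub>R w) + norm (xP - xE)"
    using norm_triangle_ineq4[of "b *\<^sub>R w" "xP - xE"] by (simp add: algebra_simps)
  then have "0 \<le> f b"
    using b assms by (simp add: f_def algebra_simps)
  moreover have "continuous_on {0..b} f"
    unfolding f_def by (intro continuous_intros)
  ultimately obtain s where "0 \<le> s" "f s = 0"
    using IVT'[of f 0 0 b] f0 b by force
  with f0 have "s > 0"
    by (cases "s = 0") auto
  with \<open>f s = 0\<close> show thesis
    by (intro that) (auto simp: f_def)
qed

text \<open>If \<open>p \<bullet> v\<close> were negative, the difference quotient along the ray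
  would stay at or above the positive number \<open>- (p \<bullet> v) / norm v\<close>, because
  \<open>f\<close> does not drop there, and the upper limit could not be nonpositive.\<close>

lemma superdifferential_inner_nonneg:
  fixes S :: "'a::real_inner set"
  assumes p: "p \<in> superdifferential S f y"
    and ray: "\<forall>\<^sub>F h in at_right 0. y + h *\<^sub>R v \<in> S \<and> f y \<le> f (y + h *\<^sub>R v)"
  shows "p \<bullet> v \<ge> 0"
proof (rule ccontr)
  assume "\<not> p \<bullet> v \<ge> 0"
  then have neg: "p \<bullet> v < 0"
    by simp
  then have v: "norm v > 0"
    by auto
  define c where "c = - (p \<bullet> v) / norm v"
  have "c > 0"
    using neg v by (simp add: c_def divide_neg_pos)
  then have "Limsup (at y within S) (\<lambda>y'. ereal ((f y' - f y - p \<bullet> (y' - y)) / norm (y' - y))) < ereal c"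
    using p by (simp add: superdifferential_def order_le_less_trans)
  then have ev: "\<forall>\<^sub>F y' in at y within S. ereal ((f y' - f y - p \<bullet> (y' - y)) / norm (y' - y)) < ereal c"
    by (rule Limsup_lessD)
  have "((\<lambda>h. y + h *\<^sub>R v) \<longlongrightarrow> y + 0 *\<^sub>R v) (at_right 0)"
    by (intro tendsto_intros)
  moreover have "\<forall>\<^sub>F h in at_right 0. y + h *\<^sub>R v \<in> S \<and> y + h *\<^sub>R v \<noteq> y"
    using ray eventually_at_right_less[of "0::real"] by eventually_elim (use v in auto)
  ultimately have "filterlim (\<lambda>h. y + h *\<^sub>R v) (at y within S) (at_right 0)"
    by (simp add: filterlim_at)
  then have "\<forall>\<^sub>F h in at_right 0.
      ereal ((f (y + h *\<^sub>R v) - f y - p \<bullet> (y + h *\<^sub>R v - y)) / norm (y + h *\<^sub>R v - y)) < ereal c"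
    using ev by (rule eventually_compose_filterlim[rotated])
  with ray eventually_at_right_less[of "0::real"] have "\<forall>\<^sub>F h in at_right (0::real). False"
  proof eventually_elim
    case (elim h)
    then have "(f (y + h *\<^sub>R v) - f y - h * (p \<bullet> v)) / (h * norm v) < c"
      by simp
    moreover have "c = (- h * (p \<bullet> v)) / (h * norm v)"
      using elim by (simp add: c_def)
    moreover have "(- h * (p \<bullet> v)) / (h * norm v) \<le> (f (y + h *\<^sub>R v) - f y - h * (p \<bullet> v)) / (h * norm v)"
      using elim v by (intro divide_right_mono) auto
    ultimately show False
      by linarith
  qed
  then show False
    by simp
qed

text \<open>The pursuers' headings \<open>e\<close> are chosen after \<open>w\<close>: each aims at
  the point where the evader's ray leaves that pursuer's own region, so the targets
  \<open>z i\<close> may differ.\<close>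

lemma pursuit_response:
  fixes \<alpha> l :: "'m::finite \<Rightarrow> real" and g :: "real ^ 'n::finite \<Rightarrow> real" and y :: "('m, 'n) state"
  assumes \<alpha>: "\<And>i. \<alpha> i > 1" and l: "\<And>i. l i \<ge> 0" and g: "locally_lipschitz g"
    and y: "y \<in> \<Omega> l" and w: "norm w = 1"
  obtains e where "\<And>i. norm (e i) = 1"
    "\<forall>\<^sub>F h in at_right 0. y + h *\<^sub>R (\<chi> i. \<alpha> i *\<^sub>R e i, w) \<in> \<Omega> l
      \<and> Vg \<alpha> l g y \<le> Vg \<alpha> l g (y + h *\<^sub>R (\<chi> i. \<alpha> i *\<^sub>R e i, w))"
proof -
  obtain xP xE where yy: "y = (xP, xE)"
    by (cases y)
  have "\<exists>s>0. norm (xE + s *\<^sub>R w - xP $ i) = \<alpha> i * s + l i" for i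
    by (rule ray_exits_dom_region[of "\<alpha> i" "l i" "xP $ i" xE w]) (use \<alpha> y w in \<open>auto simp: yy \<Omega>_def\<close>)
  then obtain s where s: "\<And>i. s i > 0" "\<And>i. norm (xE + s i *\<^sub>R w - xP $ i) = \<alpha> i * s i + l i"
    by metis
  define z where "z i = xE + s i *\<^sub>R w" for i
  define R where "R i = \<alpha> i * s i + l i" for i
  have R: "R i > 0" for i
    using \<alpha>[of i] l[of i] s(1)[of i] by (simp add: R_def add_pos_nonneg)
  define e where "e i = (z i - xP $ i) /\<^sub>R R i" for i
  have e: "norm (e i) = 1" for i
    using s(2)[of i] R[of i] by (simp add: e_def z_def R_def)
  \<comment> \<open>After time \<open>h\<close> each pair of players is again in the configuration
    of \<open>dom_region_antimono_pursuit\<close>, with remaining distance \<open>s i - h\<close> in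
    place of \<open>s i\<close>.\<close>
  have E_eq: "xE + h *\<^sub>R w = z i - (s i - h) *\<^sub>R w" for h i
    by (simp add: z_def algebra_simps)
  have "xP $ i = z i - R i *\<^sub>R e i" for i
    using R[of i] by (simp add: e_def)
  then have P_eq: "xP $ i + h *\<^sub>R (\<alpha> i *\<^sub>R e i) = z i - (\<alpha> i * (s i - h) + l i) *\<^sub>R e i" for h i
    by (simp add: R_def algebra_simps)
  let ?y = "\<lambda>h. y + h *\<^sub>R (\<chi> i. \<alpha> i *\<^sub>R e i, w)"
  have fst_y: "fst (?y h) $ i = z i - (\<alpha> i * (s i - h) + l i) *\<^sub>R e i" for h i
    using P_eq[of i h] by (simp add: yy)
  have snd_y: "snd (?y h) = z i - (s i - h) *\<^sub>R w" for h i
    using E_eq[of h i] by (simp add: yy)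
  have y0: "fst y $ i = z i - (\<alpha> i * s i + l i) *\<^sub>R e i" "snd y = z i - s i *\<^sub>R w" for i
    using fst_y[of 0 i] snd_y[of 0 i] by simp_all
  have D: "dom_region (\<alpha> i) (l i) (fst (?y h) $ i) (snd (?y h))
      \<subseteq> dom_region (\<alpha> i) (l i) (fst y $ i) (snd y)" if "0 \<le> h" "h < s i" for h i
    unfolding fst_y snd_y[of _ i] y0[of i]
    by (rule dom_region_antimono_pursuit) (use that \<alpha>[of i] l[of i] w e in \<open>simp_all add: less_imp_le\<close>)
  \<comment> \<open>Seen from \<open>z i\<close>, the pursuer is farther away than the evader by
    more than \<open>l i\<close>, so the reverse triangle inequality suffices.\<close>
  have O: "norm (fst (?y h) $ i - snd (?y h)) > l i" if "h < s i" for h i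
  proof -
    have "norm ((\<alpha> i * (s i - h) + l i) *\<^sub>R e i) - norm ((s i - h) *\<^sub>R w)
        \<le> norm (fst (?y h) $ i - snd (?y h))"
      using norm_triangle_ineq3[of "(\<alpha> i * (s i - h) + l i) *\<^sub>R e i" "(s i - h) *\<^sub>R w"]
      unfolding fst_y snd_y[of _ i] by (simp add: norm_minus_commute)
    moreover have "norm ((\<alpha> i * (s i - h) + l i) *\<^sub>R e i) = \<alpha> i * (s i - h) + l i"
      using that \<alpha>[of i] l[of i] e[of i] by simp
    moreover have "norm ((s i - h) *\<^sub>R w) = s i - h"
      using that w by simp
    moreover have "s i - h < \<alpha> i * (s i - h)"
      using that \<alpha>[of i] by simp
    ultimately show ?thesis
      by linarith
  qed
  have "\<forall>\<^sub>F h in at_right 0. \<forall>i. h < s i"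
    by (intro eventually_all_finite order_tendstoD(2)[OF tendsto_ident_at s(1)])
  with eventually_at_right_less[of "0::real"]
  have "\<forall>\<^sub>F h in at_right 0. ?y h \<in> \<Omega> l \<and> Vg \<alpha> l g y \<le> Vg \<alpha> l g (?y h)"
  proof eventually_elim
    case (elim h)
    have \<Omega>: "?y h \<in> \<Omega> l"
      using O[of h] elim by (simp add: \<Omega>_def case_prod_beta)
    have "Dstar \<alpha> l (?y h) \<subseteq> Dstar \<alpha> l y"
      unfolding Dstar_def using D[of h] elim by (intro INF_mono) auto
    then show ?case
      \<comment> \<open>A minimiser for the moved state is a competitor in the larger set for
        \<open>y\<close>.\<close>
      using Vg_is_minimum(1)[of \<alpha>, OF \<alpha> g \<Omega>] Vg_is_minimum(2)[of \<alpha>, OF \<alpha> g y] \<Omega> by auto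
  qed
  with e show thesis
    by (rule that)
qed

theorem corollary4p1:
  fixes \<alpha> l :: "'m::finite \<Rightarrow> real"
    and g :: "real ^ 'n::finite \<Rightarrow> real"
    and y :: "('m, 'n) state"
    and pP :: "(real ^ 'n) ^ 'm" and pE :: "real ^ 'n"
  assumes "CARD('n) \<ge> 2"
    and "\<And>i. \<alpha> i > 1"
    and "\<And>i. l i > 0"
    and "locally_lipschitz g"
    and "y \<in> \<Omega> l"
    and "(pP, pE) \<in> superdifferential (\<Omega> l) (Vg \<alpha> l g) y"
  shows "- (\<Sum>i\<in>UNIV. \<alpha> i * norm (pP $ i)) + norm pE \<le> 0"
proof (cases "pE = 0")
  case True
  have "0 \<le> \<alpha> i" for i
    using assms(2)[of i] by simp
  then show ?thesis
    using True by (simp add: sum_nonneg)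
next
  case False
  \<comment> \<open>This heading gives \<open>pE \<bullet> w\<close> its least value among unit
    vectors, \<open>- norm pE\<close>. The headings \<open>e\<close> returned for it enter only
    through the Cauchy-Schwarz bound on \<open>pP $ i \<bullet> e i\<close>.\<close>
  define w where "w = - pE /\<^sub>R norm pE"
  have w: "norm w = 1"
    using False by (simp add: w_def)
  obtain e where e: "\<And>i. norm (e i) = 1"
    and ray: "\<forall>\<^sub>F h in at_right 0. y + h *\<^sub>R (\<chi> i. \<alpha> i *\<^sub>R e i, w) \<in> \<Omega> l
      \<and> Vg \<alpha> l g y \<le> Vg \<alpha> l g (y + h *\<^sub>R (\<chi> i. \<alpha> i *\<^sub>R e i, w))"
    using pursuit_response[of \<alpha> l, OF assms(2) less_imp_le[OF assms(3)] assms(4,5) w] by blast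
  have "0 \<le> (pP, pE) \<bullet> (\<chi> i. \<alpha> i *\<^sub>R e i, w)"
    by (rule superdifferential_inner_nonneg[OF assms(6) ray])
  also have "\<dots> = (\<Sum>i\<in>UNIV. \<alpha> i * (pP $ i \<bullet> e i)) + pE \<bullet> w"
    by (simp add: inner_vec_def sum_distrib_left mult_ac)
  also have "pE \<bullet> w = - norm pE"
    using False by (simp add: w_def dot_square_norm power2_eq_square)
  also have "(\<Sum>i\<in>UNIV. \<alpha> i * (pP $ i \<bullet> e i)) \<le> (\<Sum>i\<in>UNIV. \<alpha> i * norm (pP $ i))"
  proof (intro sum_mono mult_left_mono)
    fix i
    show "pP $ i \<bullet> e i \<le> norm (pP $ i)"
      using norm_cauchy_schwarz[of "pP $ i" "e i"] e[of i] by simp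
    show "0 \<le> \<alpha> i"
      using assms(2)[of i] by simp
  qed
  finally show ?thesis
    by simp
qed

end
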